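(* Let $P(X) \in \mathbb{Z}[X]$ be a monic non-constant polynomial. Then there are at most finitely many composite positive integers $n$ such that $S_2(n) \mid \phi(n) - 1$ and $P(S_2(n)) \equiv 0 \pmod{\phi(n)}$, where $\phi$ is Euler's totient function and $S_2(n) = n\prod_{p \mid n}\left(1 - \frac{2}{p}\right)$.
   Context: $S_2$ is Schemmel's totient function, $S_2(n) = n\prod_{p\mid n}(1-2/p)$, the product being over the distinct primes dividing $n$. *)

theory Defs
  imports "HOL-Number_Theory.Number_Theory" "HOL-Computational_Algebra.Polynomial"
begin

text \<open>
  The floor only converts the rational product to an integer; the product is always an integer,
  as lemma \<open>of_int_schemmel\<close> shows. In particular \<open>schemmel n = 0\<close> for even \<open>n\<close>.
\<close>
definition schemmel :: "nat \<Rightarrow> int" where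
  "schemmel n = \<lfloor>rat_of_nat n * (\<Prod>p\<in>prime_factors n. 1 - 2 / rat_of_nat p)\<rfloor>"

lemma of_int_schemmel:
  "rat_of_int (schemmel n) = rat_of_nat n * (\<Prod>p\<in>prime_factors n. 1 - 2 / rat_of_nat p)"
proof (cases "n = 0")
  case True
  then show ?thesis by (simp add: schemmel_def)
next
  case False
  have "n = (\<Prod>p\<in>prime_factors n. p ^ multiplicity p n)"
    using False by (simp add: prime_factorization_nat)
  moreover have "(\<Prod>p\<in>prime_factors n. p) dvd (\<Prod>p\<in>prime_factors n. p ^ multiplicity p n)"
    by (intro prod_dvd_prod) (auto simp: prime_factors_multiplicity intro: dvd_power)
  ultimately have "(\<Prod>p\<in>prime_factors n. p) dvd n" by simp
  then obtain k where k: "n = (\<Prod>p\<in>prime_factors n. p) * k" by (elim dvdE)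
  have "rat_of_nat n * (\<Prod>p\<in>prime_factors n. 1 - 2 / rat_of_nat p)
      = rat_of_nat k * (\<Prod>p\<in>prime_factors n. rat_of_nat p * (1 - 2 / rat_of_nat p))"
    by (subst k) (simp add: prod.distrib)
  also have "(\<Prod>p\<in>prime_factors n. rat_of_nat p * (1 - 2 / rat_of_nat p))
      = (\<Prod>p\<in>prime_factors n. rat_of_int (int p - 2))"
    by (intro prod.cong) (auto simp: field_simps intro!: prime_gt_0_nat)
  finally have "rat_of_nat n * (\<Prod>p\<in>prime_factors n. 1 - 2 / rat_of_nat p)
      = rat_of_int (int k * (\<Prod>p\<in>prime_factors n. int p - 2))"
    by simp
  then show ?thesis unfolding schemmel_def by (simp only: floor_of_int)
qed

end

theory Submission
  imports Defs "HOL-Real_Asymp.Real_Asymp"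
begin

text \<open>
  Write \<open>s = S\<^sub>2(n)\<close> and \<open>\<phi> = 1 + m s\<close>. A common divisor of \<open>s\<close> and \<open>\<phi>\<close> divides \<open>1\<close>, so \<open>n\<close> is
  squarefree and odd. Modulo \<open>\<phi>\<close> the inverse of \<open>s\<close> is \<open>-m\<close>, hence \<open>\<phi>\<close> divides \<open>Q(-m)\<close>, where
  \<open>Q\<close> is the reciprocal polynomial of \<open>P\<close>. The constant term of \<open>Q\<close> is \<open>1\<close>, and \<open>m \<ge> 2\<close> since \<open>n\<close>
  is composite, so \<open>Q(-m)\<close> does not vanish and \<open>\<phi> \<le> \<bar>Q(-m)\<bar> \<le> C m\<^sup>d\<close>. If \<open>n\<close> has \<open>k\<close> prime factors
  then \<open>m \<le> k + 1\<close> and \<open>2\<^sup>k \<le> \<phi>\<close>, which bounds \<open>k\<close>, then \<open>\<phi>\<close>, then \<open>n \<le> \<phi>\<^sup>2\<close>.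
\<close>

section \<open>Products over the prime factors of \<open>n\<close>\<close>

lemma totient_schemmel_decomp:
  assumes "n > 0"
  obtains k :: nat where "n = k * \<Prod>(prime_factors n)"
    and "int (totient n) = int k * (\<Prod>p\<in>prime_factors n. int p - 1)"
    and "schemmel n = int k * (\<Prod>p\<in>prime_factors n. int p - 2)"
proof -
  have "n = (\<Prod>p\<in>prime_factors n. p ^ multiplicity p n)"
    using assms by (simp add: prime_factorization_nat)
  moreover have "\<Prod>(prime_factors n) dvd (\<Prod>p\<in>prime_factors n. p ^ multiplicity p n)"
    by (intro prod_dvd_prod) (auto simp: prime_factors_multiplicity intro: dvd_power)
  ultimately have "\<Prod>(prime_factors n) dvd n" by simp
  \<comment> \<open>The radical of \<open>n\<close> clears the denominators \<open>p\<close> in both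
    product formulas, so its cofactor \<open>k\<close> survives as a common divisor of both
    values.\<close>
  then obtain k where k: "n = k * \<Prod>(prime_factors n)"
    by (metis dvdE mult.commute)
  have pos: "p > 0" if "p \<in> prime_factors n" for p
    using that by (auto intro: prime_gt_0_nat)
  have "real_of_int (int (totient n)) = real n * (\<Prod>p\<in>prime_factors n. 1 - 1 / real p)"
    by (simp add: totient_formula2)
  also have "\<dots> = real k * (\<Prod>p\<in>prime_factors n. real p * (1 - 1 / real p))"
    by (subst k) (simp add: prod.distrib)
  also have "(\<Prod>p\<in>prime_factors n. real p * (1 - 1 / real p))
      = (\<Prod>p\<in>prime_factors n. real_of_int (int p - 1))"
    using pos by (intro prod.cong) (auto simp: field_simps)
  also have "real k * \<dots> = real_of_int (int k * (\<Prod>p\<in>prime_factors n. int p - 1))"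
    by simp
  finally have t: "int (totient n) = int k * (\<Prod>p\<in>prime_factors n. int p - 1)"
    by (simp only: of_int_eq_iff)
  have "rat_of_int (schemmel n) = rat_of_nat n * (\<Prod>p\<in>prime_factors n. 1 - 2 / rat_of_nat p)"
    by (rule of_int_schemmel)
  also have "\<dots> = rat_of_nat k * (\<Prod>p\<in>prime_factors n. rat_of_nat p * (1 - 2 / rat_of_nat p))"
    by (subst k) (simp add: prod.distrib)
  also have "(\<Prod>p\<in>prime_factors n. rat_of_nat p * (1 - 2 / rat_of_nat p))
      = (\<Prod>p\<in>prime_factors n. rat_of_int (int p - 2))"
    using pos by (intro prod.cong) (auto simp: field_simps)
  also have "rat_of_nat k * \<dots> = rat_of_int (int k * (\<Prod>p\<in>prime_factors n. int p - 2))"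
    by simp
  finally have "schemmel n = int k * (\<Prod>p\<in>prime_factors n. int p - 2)"
    by (simp only: of_int_eq_iff)
  with k t show thesis by (rule that)
qed

text \<open>The \<open>i\<close>-th smallest element is at least \<open>i + 2\<close>, so its ratio
  \<open>(p - 1) / (p - 2)\<close> is at most \<open>(i + 1) / i\<close>, and these bounds
  telescope. Hence the induction inserts elements in increasing order. Only distinctness is used,
  not primality.\<close>

lemma prod_minus_1_le_card_prod_minus_2:
  fixes A :: "nat set"
  assumes "finite A" "\<And>p. p \<in> A \<Longrightarrow> p \<ge> 3"
  shows "(\<Prod>p\<in>A. int p - 1) \<le> (int (card A) + 1) * (\<Prod>p\<in>A. int p - 2)"
  using assms
proof (induction A rule: finite_linorder_max_induct)
  case empty
  then show ?case by simp
next
  case (insert b A)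
  let ?k = "int (card A)" and ?S = "\<Prod>p\<in>A. int p - 2"
  have S: "?S \<ge> 0" using insert.prems by (intro prod_nonneg) force
  have "A \<subseteq> {3..<b}" using insert by fastforce
  then have "card A \<le> b - 3" using card_mono[of "{3..<b}" A] by simp
  moreover have b: "b \<ge> 3" using insert.prems by simp
  ultimately have kb: "?k + 3 \<le> int b" by linarith
  have notin: "b \<notin> A" using insert by blast
  have "(\<Prod>p\<in>insert b A. int p - 1) = (int b - 1) * (\<Prod>p\<in>A. int p - 1)"
    using insert notin by simp
  also have "\<dots> \<le> (int b - 1) * ((?k + 1) * ?S)"
    using b by (intro mult_left_mono insert.IH insert.prems) auto
  also have "\<dots> = ((int b - 1) * (?k + 1)) * ?S" by (simp add: mult.assoc)
  \<comment> \<open>The two brackets differ by exactly \<open>int b - ?k - 3\<close>.\<close>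
  also have "\<dots> \<le> ((?k + 2) * (int b - 2)) * ?S"
    using kb by (intro mult_right_mono S) (simp add: algebra_simps)
  also have "\<dots> = (int (card (insert b A)) + 1) * (\<Prod>p\<in>insert b A. int p - 2)"
    using insert notin by (simp add: algebra_simps)
  finally show ?case .
qed

text \<open>Each new factor widens the gap between the products by at least 1. With two or more
  primes the gap is at least 2, which later excludes the quotient \<open>m = 1\<close>.\<close>

lemma prod_minus_2_add_card_le:
  fixes A :: "nat set"
  assumes "finite A" "\<And>p. p \<in> A \<Longrightarrow> p \<ge> 3"
  shows "(\<Prod>p\<in>A. int p - 2) + int (card A) \<le> (\<Prod>p\<in>A. int p - 1)"
  using assms
proof (induction A rule: finite_induct)
  case empty
  then show ?case by simp
next
  case (insert b A)
  let ?k = "int (card A)" and ?S = "\<Prod>p\<in>A. int p - 2"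
  have S: "?S \<ge> 1" using insert.prems by (intro prod_ge_1) force
  have b: "b \<ge> 3" using insert.prems by simp
  have "?k * 1 \<le> ?k * (int b - 1)" using b by (intro mult_left_mono) auto
  then have "(int b - 2) * ?S + (?k + 1) \<le> (int b - 1) * (?S + ?k)"
    using S by (simp add: algebra_simps)
  also have "\<dots> \<le> (int b - 1) * (\<Prod>p\<in>A. int p - 1)"
    using b by (intro mult_left_mono insert.IH insert.prems) auto
  finally show ?case using insert by (simp add: algebra_simps)
qed

lemma two_power_card_le_prod_minus_1:
  fixes A :: "nat set"
  assumes "\<And>p. p \<in> A \<Longrightarrow> p \<ge> 3"
  shows "2 ^ card A \<le> (\<Prod>p\<in>A. int p - 1)"
proof -
  have "(\<Prod>p\<in>A. 2 :: int) \<le> (\<Prod>p\<in>A. int p - 1)"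
    using assms by (intro prod_mono) force
  then show ?thesis by simp
qed

lemma prod_le_prod_minus_1_square:
  fixes A :: "nat set"
  assumes "\<And>p. p \<in> A \<Longrightarrow> p \<ge> 3"
  shows "int (\<Prod>A) \<le> (\<Prod>p\<in>A. int p - 1) ^ 2"
proof -
  have "int p \<le> (int p - 1) ^ 2" if "p \<in> A" for p
  proof -
    have "int p * 3 \<le> int p * int p"
      using assms[OF that] by (intro mult_left_mono) auto
    then show ?thesis by (simp add: power2_eq_square algebra_simps)
  qed
  then have "(\<Prod>p\<in>A. int p) \<le> (\<Prod>p\<in>A. (int p - 1) ^ 2)"
    by (intro prod_mono) auto
  then show ?thesis by (simp add: prod_power_distrib)
qed

section \<open>Reciprocal polynomials and growth\<close>

lemma poly_eq_sum_atMost: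
  fixes Q :: "'a::comm_semiring_1 poly"
  assumes "degree Q \<le> d"
  shows "poly Q x = (\<Sum>i\<le>d. coeff Q i * x ^ i)"
  unfolding poly_altdef using assms
  by (intro sum.mono_neutral_left) (auto simp: coeff_eq_0)

text \<open>Distributing \<open>y ^ degree P\<close> over the terms of \<open>poly P x\<close> pairs
  every \<open>x\<close> with a \<open>y\<close>; each pair is 1 modulo \<open>n\<close>, and the
  leftover powers of \<open>y\<close> carry the coefficients in reverse order.\<close>

lemma poly_reflect_poly_cong:
  fixes P :: "int poly"
  assumes "[x * y = 1] (mod n)"
  shows "[y ^ degree P * poly P x = poly (reflect_poly P) y] (mod n)"
proof -
  let ?d = "degree P"
  have "y ^ ?d * poly P x = (\<Sum>i\<le>?d. y ^ ?d * (coeff P i * x ^ i))"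
    by (simp add: poly_altdef sum_distrib_left)
  also have "\<dots> = (\<Sum>i\<le>?d. coeff P i * y ^ (?d - i) * (x * y) ^ i)"
  proof (intro sum.cong refl)
    fix i assume "i \<in> {..?d}"
    then have "y ^ ?d = y ^ (?d - i) * y ^ i" by (simp flip: power_add)
    then show "y ^ ?d * (coeff P i * x ^ i) = coeff P i * y ^ (?d - i) * (x * y) ^ i"
      by (simp add: power_mult_distrib mult_ac)
  qed
  also have "[\<dots> = (\<Sum>i\<le>?d. coeff P i * y ^ (?d - i) * 1 ^ i)] (mod n)"
    by (intro cong_sum cong_mult cong_pow cong_refl assms)
  also have "(\<Sum>i\<le>?d. coeff P i * y ^ (?d - i) * 1 ^ i) = (\<Sum>i\<le>?d. coeff P (?d - i) * y ^ i)"
    by (rule sum.reindex_bij_witness[of _ "\<lambda>i. ?d - i" "\<lambda>i. ?d - i"]) auto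
  also have "\<dots> = (\<Sum>i\<le>?d. coeff (reflect_poly P) i * y ^ i)"
    by (intro sum.cong) (auto simp: coeff_reflect_poly)
  \<comment> \<open>The degree of \<open>reflect_poly P\<close> drops below \<open>degree P\<close>
    when the constant coefficient of \<open>P\<close> is 0, so the sum may contain zero terms at the
    top.\<close>
  also have "\<dots> = poly (reflect_poly P) y"
    by (rule poly_eq_sum_atMost[OF degree_reflect_poly_le, symmetric])
  finally show ?thesis .
qed

text \<open>Modulo \<open>x\<close> the value is 1, so a root would be a unit.\<close>

lemma poly_nonzero_if_coeff_0_eq_1:
  fixes Q :: "int poly"
  assumes "coeff Q 0 = 1" "\<bar>x\<bar> \<ge> 2"
  shows "poly Q x \<noteq> 0"
proof
  assume "poly Q x = 0"
  moreover obtain R where "Q = pCons 1 R"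
    using assms(1) by (cases Q) auto
  ultimately have "x * (- poly R x) = 1" by simp
  then have "x dvd 1" by (metis dvd_triv_left)
  then show False using assms(2) by simp
qed

lemma abs_poly_le_sum_abs_coeff:
  fixes Q :: "int poly"
  assumes "\<bar>x\<bar> \<ge> 1" "degree Q \<le> d"
  shows "\<bar>poly Q x\<bar> \<le> (\<Sum>i\<le>d. \<bar>coeff Q i\<bar>) * \<bar>x\<bar> ^ d"
proof -
  have "\<bar>poly Q x\<bar> \<le> (\<Sum>i\<le>d. \<bar>coeff Q i * x ^ i\<bar>)"
    unfolding poly_eq_sum_atMost[OF assms(2)] by (rule sum_abs)
  also have "\<dots> \<le> (\<Sum>i\<le>d. \<bar>coeff Q i\<bar> * \<bar>x\<bar> ^ d)"
    unfolding abs_mult power_abs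
    using assms by (intro sum_mono mult_left_mono power_increasing) auto
  finally show ?thesis by (simp add: sum_distrib_right)
qed

lemma finite_two_power_le_poly_growth:
  "finite {k::nat. (2::int) ^ k \<le> C * (int k + 1) ^ d}"
proof -
  have "eventually (\<lambda>k::nat. real_of_int C * (real k + 1) ^ d < 2 ^ k) at_top"
    by real_asymp
  then obtain K where K: "\<And>k. k \<ge> K \<Longrightarrow> real_of_int C * (real k + 1) ^ d < 2 ^ k"
    by (auto simp: eventually_at_top_linorder)
  have "k < K" if "(2::int) ^ k \<le> C * (int k + 1) ^ d" for k
  proof (rule ccontr)
    assume "\<not> k < K"
    then have "real_of_int (C * (int k + 1) ^ d) < real_of_int (2 ^ k)"
      using K[of k] by simp
    with that show False by (simp only: of_int_less_iff)
  qed
  then show ?thesis by (auto intro: finite_subset[of _ "{..<K}"])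
qed

section \<open>Constraints on the composite solutions\<close>

lemma composite_schemmel_dvd:
  assumes n: "n > 1" "\<not> prime n" and dvd: "schemmel n dvd int (totient n) - 1"
  shows "n = \<Prod>(prime_factors n)"
    and "int (totient n) = (\<Prod>p\<in>prime_factors n. int p - 1)"
    and "schemmel n = (\<Prod>p\<in>prime_factors n. int p - 2)"
    and "\<And>p. p \<in> prime_factors n \<Longrightarrow> p \<ge> 3"
    and "card (prime_factors n) \<ge> 2"
proof -
  let ?A = "prime_factors n"
  obtain k where k: "n = k * \<Prod>?A"
    "int (totient n) = int k * (\<Prod>p\<in>?A. int p - 1)"
    "schemmel n = int k * (\<Prod>p\<in>?A. int p - 2)"
    using totient_schemmel_decomp[of n] n by auto
  have "int k dvd int (totient n) - 1"
    using k(3) dvd by (metis dvd_mult_left)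
  moreover have "int k dvd int (totient n)" using k(2) by simp
  ultimately have "int k dvd 1"
    using dvd_diff[of "int k" "int (totient n)" "int (totient n) - 1"]
    by (simp only: diff_diff_eq2 add_diff_cancel_left')
  then have "k = 1" by simp
  with k show nA: "n = \<Prod>?A" and t: "int (totient n) = (\<Prod>p\<in>?A. int p - 1)"
    and s: "schemmel n = (\<Prod>p\<in>?A. int p - 2)" by simp_all
  have "card ?A \<noteq> 0" using nA n by auto
  moreover have "card ?A \<noteq> 1"
  proof
    assume "card ?A = 1"
    then obtain p where p: "?A = {p}" by (auto simp: card_1_singleton_iff)
    then have "n = p" using nA by simp
    moreover have "prime p" using p by (metis in_prime_factors_imp_prime singletonI)
    ultimately show False using n by simp
  qed
  ultimately show c: "card ?A \<ge> 2" by linarith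
  show "p \<ge> 3" if p: "p \<in> ?A" for p
  proof (rule ccontr)
    assume "\<not> p \<ge> 3"
    moreover have "p \<ge> 2" using in_prime_factors_imp_prime[OF p] by (rule prime_ge_2_nat)
    ultimately have "p = 2" by linarith
    then have "2 \<in> ?A" using p by simp
    \<comment> \<open>The prime 2 contributes the factor 0, and 0 divides only 0, so the totient
      would be 1.\<close>
    then have "schemmel n = 0" using s by (auto intro!: prod_zero)
    then have "totient n = 1" using dvd by simp
    then have "(\<Prod>p\<in>?A. int p - 1) = 1" using t by simp
    \<comment> \<open>A second prime \<open>q\<close> contradicts this: \<open>q - 1\<close> is at
      least 2 and would divide 1.\<close>
    moreover have "\<not> ?A \<subseteq> {2}" using c card_mono[of "{2::nat}" ?A] by auto
    then obtain q where q: "q \<in> ?A" "q \<noteq> 2" by blast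
    ultimately have "int q - 1 dvd 1"
      by (metis dvd_prodI finite_set_mset)
    moreover have "q \<ge> 2" using in_prime_factors_imp_prime[OF q(1)] by (rule prime_ge_2_nat)
    ultimately show False using q by simp
  qed
qed

text \<open>\<open>C\<close> depends on \<open>P\<close> alone, so the first two bounds set an
  exponential in \<open>k\<close> against a fixed polynomial in \<open>k\<close>; the third
  transfers the bound to \<open>n\<close>.\<close>

lemma composite_totient_bounds:
  fixes P :: "int poly"
  defines "C \<equiv> \<Sum>i\<le>degree P. \<bar>coeff (reflect_poly P) i\<bar>"
  assumes P: "lead_coeff P = 1"
    and n: "n > 1" "\<not> prime n" and dvd: "schemmel n dvd int (totient n) - 1"
    and cong: "[poly P (schemmel n) = 0] (mod int (totient n))"
  defines "k \<equiv> card (prime_factors n)"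
  shows "2 ^ k \<le> int (totient n)"
    and "int (totient n) \<le> C * (int k + 1) ^ degree P"
    and "int n \<le> int (totient n) ^ 2"
proof -
  let ?A = "prime_factors n" and ?Q = "reflect_poly P"
  let ?t = "int (totient n)" and ?s = "schemmel n"
  note [simp] = composite_schemmel_dvd(4)[OF n dvd]
  note n_eq = composite_schemmel_dvd(1)[OF n dvd] and t = composite_schemmel_dvd(2)[OF n dvd]
    and s = composite_schemmel_dvd(3)[OF n dvd] and k2 = composite_schemmel_dvd(5)[OF n dvd]
  show two: "2 ^ k \<le> ?t"
    unfolding t k_def by (rule two_power_card_le_prod_minus_1) simp
  show "int n \<le> ?t ^ 2"
    using prod_le_prod_minus_1_square[of ?A] n_eq t by simp
  have s1: "?s \<ge> 1" unfolding s
    by (intro prod_ge_1) (use composite_schemmel_dvd(4)[OF n dvd] in force)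
  have tk: "?t \<le> (int k + 1) * ?s"
    unfolding t s k_def by (rule prod_minus_1_le_card_prod_minus_2) auto
  have st: "?s + int k \<le> ?t"
    unfolding t s k_def by (rule prod_minus_2_add_card_le) auto
  obtain m where "?t - 1 = ?s * m" using dvd by (auto elim: dvdE)
  then have m: "?t = 1 + ?s * m" by simp
  \<comment> \<open>Since \<open>k\<close> is at least 2,
    \<open>?s + 2 \<le> ?t = 1 + ?s * m\<close>.\<close>
  have "?s * 1 < ?s * m" using m st k2 unfolding k_def by linarith
  then have m2: "m \<ge> 2" using s1 by (simp add: mult_less_cancel_left_pos)
  have "?s * m < ?s * (int k + 1)" using m tk by (simp add: mult.commute)
  then have mk: "m \<le> int k + 1" using s1 by (simp add: mult_less_cancel_left_pos)
  have "?s * (- m) - 1 = - ?t" using m by simp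
  then have "[?s * (- m) = 1] (mod ?t)" by (simp add: cong_iff_dvd_diff)
  then have "[(- m) ^ degree P * poly P ?s = poly ?Q (- m)] (mod ?t)"
    by (rule poly_reflect_poly_cong)
  moreover have "[(- m) ^ degree P * poly P ?s = (- m) ^ degree P * 0] (mod ?t)"
    by (intro cong_mult cong_refl cong)
  ultimately have "[poly ?Q (- m) = 0] (mod ?t)"
    by (metis cong_sym cong_trans mult_zero_right)
  then have "?t dvd poly ?Q (- m)" by (simp add: cong_0_iff)
  \<comment> \<open>The constant coefficient of \<open>?Q\<close> is the leading coefficient of
    \<open>P\<close>. Nonvanishing turns the divisibility into a size bound.\<close>
  moreover have "poly ?Q (- m) \<noteq> 0"
    using P m2 by (intro poly_nonzero_if_coeff_0_eq_1) auto
  ultimately have "?t \<le> \<bar>poly ?Q (- m)\<bar>"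
    by (metis dvd_imp_le_int abs_of_nat)
  also have "\<dots> \<le> C * \<bar>- m\<bar> ^ degree P"
    unfolding C_def using m2 by (intro abs_poly_le_sum_abs_coeff degree_reflect_poly_le) auto
  also have "\<dots> \<le> C * (int k + 1) ^ degree P"
    using m2 mk unfolding C_def by (intro mult_left_mono power_mono sum_nonneg) auto
  finally show "?t \<le> C * (int k + 1) ^ degree P" .
qed

theorem theorem1p3:
  fixes P :: "int poly"
  assumes "lead_coeff P = 1" and "degree P > 0"
  shows "finite {n::nat. n > 1 \<and> \<not> prime n \<and>
           schemmel n dvd int (totient n) - 1 \<and>
           [poly P (schemmel n) = 0] (mod int (totient n))}"
proof -
  define C where "C = (\<Sum>i\<le>degree P. \<bar>coeff (reflect_poly P) i\<bar>)"
  define B where "B = (\<lambda>k. C * (int k + 1) ^ degree P)"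
  \<comment> \<open>Sorting the solutions by their number \<open>k\<close> of prime factors leaves
    finitely many \<open>k\<close>, each with a bounded range of \<open>n\<close>.\<close>
  have "n \<in> (\<Union>k\<in>{k. 2 ^ k \<le> B k}. {..nat (B k ^ 2)})"
    if "n > 1" "\<not> prime n" "schemmel n dvd int (totient n) - 1"
      "[poly P (schemmel n) = 0] (mod int (totient n))" for n
  proof -
    note bounds = composite_totient_bounds[OF assms(1) that, folded C_def]
    define k where "k = card (prime_factors n)"
    have B: "int (totient n) \<le> B k" using bounds(2) by (simp add: B_def k_def)
    have "2 ^ k \<le> B k" using order_trans[OF bounds(1)] B by (simp only: k_def)
    moreover have "int n \<le> B k ^ 2"
      by (rule order_trans[OF bounds(3) power_mono[OF B]]) simp
    then have "n \<le> nat (B k ^ 2)" by linarith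
    ultimately show ?thesis by blast
  qed
  moreover have "finite (\<Union>k\<in>{k. 2 ^ k \<le> B k}. {..nat (B k ^ 2)})"
    unfolding B_def using finite_two_power_le_poly_growth by blast
  ultimately show ?thesis by (blast intro: finite_subset)
qed

end
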